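(* Let $d\ge2$ and work on $\mathbb{R}^d$. Fix $r\ge1$ and $k_1\gg1$ (sufficiently large). Then there exists $k_0=k_0(r)>0$ such that for any $k\ge k_1$ the following holds. Let $\psi_0\in H^{k+k_0}(\mathbb{R}^d)$; for $c>0$ let $\psi_r$ be the solution of the linearized normal form equation of order $r$ $$-i\,\partial_t\psi_r=\Big(c^2+\sum_{j=1}^r\frac{a_j}{c^{2(j-1)}}\Delta^j\Big)\psi_r,\qquad\psi_r(0)=\psi_0,$$ and let $\psi$ be the solution of the linear Klein-Gordon equation $$-i\,\partial_t\psi=c\langle\nabla\rangle_c\,\psi,\qquad\psi(0)=\psi_0 .$$ Then there exists $c^\ast=c^\ast(r,k)>0$ such that for any $c>c^\ast$ $$\sup_{t\in[0,T]}\|\psi(t)-\psi_r(t)\|_{H^k_x}\le\frac{K}{c^2}\qquad\text{whenever }T\le A\,c^{2(r-1)},$$ where $A>0$ is any constant independent of $c$ and $K>0$ does not depend on $c$.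
   Context: $\langle\nabla\rangle_c:=(c^2-\Delta)^{1/2}$ is the Fourier multiplier with symbol $(c^2+|\xi|^2)^{1/2}$. The real coefficients $a_j$ are those of the formal expansion $c\langle\nabla\rangle_c-c^2\sim\sum_{j\ge1}c^{-2(j-1)}a_j\Delta^j$ in powers of $c^{-2}$, i.e. $a_j=(-1)^j\binom{1/2}{j}$ (so $a_1=-\frac12$, $a_2=-\frac18$). $H^k=W^{k,2}(\mathbb{R}^d)$. *)

theory Defs
  imports "HOL-Analysis.Analysis"
begin

section \<open>Square-integrable functions and the Fourier transform on \<open>L\<^sup>2\<close>\<close>

text \<open>Elements of \<open>L\<^sup>2\<close> are represented by Borel functions; equality of classes is equality
  almost everywhere.\<close>

definition square_integrable :: "(real ^ 'n \<Rightarrow> complex) \<Rightarrow> bool" where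
  "square_integrable f \<longleftrightarrow>
     f \<in> borel_measurable lborel \<and> integrable lborel (\<lambda>x. (norm (f x))\<^sup>2)"

text \<open>The unitary normalisation is used. For square-integrable \<open>f\<close> the integral over a ball
  converges absolutely.\<close>

definition truncated_fourier :: "(real ^ 'n \<Rightarrow> complex) \<Rightarrow> nat \<Rightarrow> real ^ 'n \<Rightarrow> complex" where
  "truncated_fourier f N \<xi> =
     complex_of_real ((2 * pi) powr (- real CARD('n) / 2)) *
     (LINT x:cball 0 (real N)|lborel. exp (- \<i> * complex_of_real (x \<bullet> \<xi>)) * f x)"

text \<open>The Fourier--Plancherel transform, as a relation: \<open>g\<close> is the \<open>L\<^sup>2\<close> limit of the
  truncated transforms of \<open>f\<close>. By Plancherel's theorem such a \<open>g\<close> exists for every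
  square-integrable \<open>f\<close>, and it is unique up to null sets. The nonnegative integral excludes
  spurious limits arising from non-integrable differences.\<close>

definition has_fourier :: "(real ^ 'n \<Rightarrow> complex) \<Rightarrow> (real ^ 'n \<Rightarrow> complex) \<Rightarrow> bool" where
  "has_fourier f g \<longleftrightarrow> square_integrable f \<and> square_integrable g \<and>
     (\<lambda>N. \<integral>\<^sup>+ \<xi>. ennreal ((norm (g \<xi> - truncated_fourier f N \<xi>))\<^sup>2) \<partial>lborel)
       \<longlonglongrightarrow> 0"

definition fourier :: "(real ^ 'n \<Rightarrow> complex) \<Rightarrow> real ^ 'n \<Rightarrow> complex" where
  "fourier f = (SOME g. has_fourier f g)"

section \<open>The Sobolev spaces \<open>H\<^sup>s = W\<^sup>s\<^sup>,\<^sup>2\<close>\<close>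

text \<open>Bessel-potential definition, for real order \<open>s \<ge> 0\<close>.\<close>

definition sobolev_space :: "real \<Rightarrow> (real ^ 'n \<Rightarrow> complex) set" where
  "sobolev_space s = {f. \<exists>g. has_fourier f g \<and>
     square_integrable (\<lambda>\<xi>. complex_of_real ((1 + (norm \<xi>)\<^sup>2) powr (s / 2)) * g \<xi>)}"

text \<open>Only meaningful on \<^term>\<open>sobolev_space s\<close>.\<close>

definition sobolev_norm :: "real \<Rightarrow> (real ^ 'n \<Rightarrow> complex) \<Rightarrow> real" where
  "sobolev_norm s f =
     sqrt (LINT \<xi>|lborel. (norm (complex_of_real ((1 + (norm \<xi>)\<^sup>2) powr (s / 2)) * fourier f \<xi>))\<^sup>2)"

section \<open>Fourier multipliers\<close>

text \<open>Unbounded operators on \<open>L\<^sup>2\<close> are given by their graphs: \<open>P f h\<close> says that \<open>f\<close> lies in the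
  domain of \<open>P\<close> and that \<open>h\<close> represents \<open>P f\<close>.\<close>

definition fourier_multiplier ::
  "(real ^ 'n \<Rightarrow> complex) \<Rightarrow> (real ^ 'n \<Rightarrow> complex) \<Rightarrow> (real ^ 'n \<Rightarrow> complex) \<Rightarrow> bool" where
  "fourier_multiplier m f h \<longleftrightarrow> (\<exists>g. has_fourier f g \<and> has_fourier h (\<lambda>\<xi>. m \<xi> * g \<xi>))"

definition laplacian :: "(real ^ 'n \<Rightarrow> complex) \<Rightarrow> (real ^ 'n \<Rightarrow> complex) \<Rightarrow> bool" where
  "laplacian = fourier_multiplier (\<lambda>\<xi>. complex_of_real (- (norm \<xi>)\<^sup>2))"

text \<open>The operator \<open>(c\<^sup>2 - \<Delta>)\<^sup>1\<^sup>/\<^sup>2\<close>.\<close>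

definition bracket_nabla ::
  "real \<Rightarrow> (real ^ 'n \<Rightarrow> complex) \<Rightarrow> (real ^ 'n \<Rightarrow> complex) \<Rightarrow> bool" where
  "bracket_nabla c = fourier_multiplier (\<lambda>\<xi>. complex_of_real (sqrt (c\<^sup>2 + (norm \<xi>)\<^sup>2)))"

definition klein_gordon_operator ::
  "real \<Rightarrow> (real ^ 'n \<Rightarrow> complex) \<Rightarrow> (real ^ 'n \<Rightarrow> complex) \<Rightarrow> bool" where
  "klein_gordon_operator c f v \<longleftrightarrow>
     (\<exists>h. bracket_nabla c f h \<and> v = (\<lambda>x. complex_of_real c * h x))"

text \<open>The coefficients of \<open>c\<^sup>2 (1 - \<Delta> / c\<^sup>2)\<^sup>1\<^sup>/\<^sup>2 - c\<^sup>2 = (\<Sum>j\<ge>1. a\<^sub>j \<Delta>\<^sup>j / c\<^bsup>2 (j - 1)\<^esup>)\<close>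
  given by the binomial series.\<close>

definition nf_coeff :: "nat \<Rightarrow> real" where
  "nf_coeff j = (- 1) ^ j * ((1 / 2) gchoose j)"

definition normal_form_operator ::
  "nat \<Rightarrow> real \<Rightarrow> (real ^ 'n \<Rightarrow> complex) \<Rightarrow> (real ^ 'n \<Rightarrow> complex) \<Rightarrow> bool" where
  "normal_form_operator r c f v \<longleftrightarrow>
     (\<exists>h. (\<forall>j\<in>{1..r}. (laplacian ^^ j) f (h j)) \<and>
       v = (\<lambda>x. complex_of_real (c\<^sup>2) * f x +
                 (\<Sum>j=1..r. complex_of_real (nf_coeff j / c ^ (2 * (j - 1))) * h j x)))"

section \<open>Solutions of the evolution equations\<close>

text \<open>Strong differentiability in \<open>L\<^sup>2 = H\<^sup>0\<close>, one-sided at time \<open>0\<close>.\<close>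

definition has_time_derivative ::
  "(real \<Rightarrow> real ^ 'n \<Rightarrow> complex) \<Rightarrow> (real ^ 'n \<Rightarrow> complex) \<Rightarrow> real \<Rightarrow> bool" where
  "has_time_derivative u w t \<longleftrightarrow>
     ((\<lambda>s. sobolev_norm 0 (\<lambda>x. (u s x - u t x) / complex_of_real (s - t) - w x))
       \<longlongrightarrow> 0) (at t within {0..})"

text \<open>Strong solutions on \<open>[0, \<infinity>)\<close> of \<open>- i \<partial>\<^sub>t u = P u\<close>, \<open>u(0) = u\<^sub>0\<close>: at each time \<open>u\<close> lies in the
  domain of \<open>P\<close> and the equation holds in \<open>L\<^sup>2\<close>. For the operators above these solutions
  are unique, and they exist whenever \<open>u\<^sub>0\<close> is in the domain of \<open>P\<close>.\<close>

definition solves_evolution ::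
  "((real ^ 'n \<Rightarrow> complex) \<Rightarrow> (real ^ 'n \<Rightarrow> complex) \<Rightarrow> bool) \<Rightarrow>
   (real ^ 'n \<Rightarrow> complex) \<Rightarrow> (real \<Rightarrow> real ^ 'n \<Rightarrow> complex) \<Rightarrow> bool" where
  "solves_evolution P u0 u \<longleftrightarrow>
     (AE x in lborel. u 0 x = u0 x) \<and>
     (\<forall>t\<ge>0. u t \<in> sobolev_space 0 \<and>
        (\<exists>w v. w \<in> sobolev_space 0 \<and> has_time_derivative u w t \<and> P (u t) v \<and>
           (AE x in lborel. - \<i> * w x = v x)))"

end

theory Submission
  imports Defs
begin

text \<open>Both equations are diagonal on the Fourier side: a strong solution has transform
  \<open>e\<^sup>i\<^sup>t\<^sup>m g\<close>, where \<open>m\<close> is the real symbol of the operator and \<open>g\<close> the transform of the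
  initial datum. With \<open>y = \<bar>\<xi>\<bar>\<^sup>2 / c\<^sup>2\<close> the two symbols are \<open>c\<^sup>2\<close> times \<open>(1 + y)\<^sup>1\<^sup>/\<^sup>2\<close> and \<open>c\<^sup>2\<close> times
  its Taylor polynomial of degree \<open>r\<close>, so they differ by at most a constant times
  \<open>c\<^sup>2 y\<^bsup>r + 1\<^esup> = \<bar>\<xi>\<bar>\<^bsup>2 r + 2\<^esup> / c\<^bsup>2 r\<^esup>\<close>. Integrating over a time of order \<open>c\<^bsup>2 (r - 1)\<^esup>\<close> leaves an error
  of order \<open>\<bar>\<xi>\<bar>\<^bsup>2 r + 2\<^esup> / c\<^sup>2\<close> in the phase, which costs \<open>k\<^sub>0 = 2 r + 2\<close> derivatives.\<close>

section \<open>Square-integrable functions and the Fourier--Plancherel relation\<close>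

text \<open>The Bochner integral is 0 on a non-integrable function, so this value is the L2 norm
  only for a \<open>square_integrable\<close> argument.\<close>

definition l2_norm :: "(real ^ 'n \<Rightarrow> complex) \<Rightarrow> real" where
  "l2_norm f = sqrt (LINT x|lborel. (norm (f x))\<^sup>2)"

text \<open>Young's inequality for the cross term. The free weight e is chosen in
  \<open>l2_norm_triangle\<close>; e = 1 gives the crude bound with factor 2.\<close>

lemma norm_add_power2_le:
  fixes a b :: "'a::real_normed_vector"
  assumes "e > 0"
  shows "(norm (a + b))\<^sup>2 \<le> (1 + e) * (norm a)\<^sup>2 + (1 + 1 / e) * (norm b)\<^sup>2"
proof -
  have "(norm (a + b))\<^sup>2 \<le> (norm a + norm b)\<^sup>2"
    by (intro power_mono norm_triangle_ineq) auto
  also have "\<dots> \<le> (1 + e) * (norm a)\<^sup>2 + (1 + 1 / e) * (norm b)\<^sup>2"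
  proof -
    have "(1 + e) * (norm a)\<^sup>2 + (1 + 1 / e) * (norm b)\<^sup>2 - (norm a + norm b)\<^sup>2
        = (e * norm a - norm b)\<^sup>2 / e"
      using assms by (simp add: field_simps power2_eq_square)
    moreover have "\<dots> \<ge> 0"
      using assms by simp
    ultimately show ?thesis by linarith
  qed
  finally show ?thesis .
qed

lemma norm_add_power2_le_2:
  fixes a b :: "'a::real_normed_vector"
  shows "(norm (a + b))\<^sup>2 \<le> 2 * (norm a)\<^sup>2 + 2 * (norm b)\<^sup>2"
  using norm_add_power2_le[of 1 a b] by simp

lemma square_integrable_measurable [dest, measurable_dest]:
  "square_integrable f \<Longrightarrow> f \<in> borel_measurable borel"
  by (simp add: square_integrable_def)

lemma square_integrable_integrable:
  "square_integrable f \<Longrightarrow> integrable lborel (\<lambda>x. (norm (f x))\<^sup>2)"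
  by (simp add: square_integrable_def)

lemma square_integrable_bound:
  fixes f g :: "real ^ 'n \<Rightarrow> complex"
  assumes g: "square_integrable g" and f [measurable]: "f \<in> borel_measurable borel"
    and le: "AE x in lborel. norm (f x) \<le> C * norm (g x)"
  shows "square_integrable f"
  unfolding square_integrable_def
proof
  show "f \<in> borel_measurable lborel" by simp
  show "integrable lborel (\<lambda>x. (norm (f x))\<^sup>2)"
  proof (rule Bochner_Integration.integrable_bound)
    show "integrable lborel (\<lambda>x. C\<^sup>2 * (norm (g x))\<^sup>2)"
      using square_integrable_integrable[OF g] by simp
    show "AE x in lborel. norm ((norm (f x))\<^sup>2) \<le> norm (C\<^sup>2 * (norm (g x))\<^sup>2)"
      using le
    proof eventually_elim
      case (elim x)
      have "(norm (f x))\<^sup>2 \<le> (C * norm (g x))\<^sup>2"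
        by (intro power_mono elim) auto
      then show ?case by (simp add: power_mult_distrib)
    qed
  qed simp
qed

lemma square_integrable_scale:
  assumes "square_integrable f"
  shows "square_integrable (\<lambda>x. a * f x)"
  using square_integrable_measurable[OF assms]
  by (intro square_integrable_bound[OF assms, where C = "norm a"]) (auto simp: norm_mult)

lemma square_integrable_add:
  fixes f g :: "real ^ 'n \<Rightarrow> complex"
  assumes f: "square_integrable f" and g: "square_integrable g"
  shows "square_integrable (\<lambda>x. f x + g x)"
proof -
  note [measurable] = square_integrable_measurable[OF f] square_integrable_measurable[OF g]
  have "integrable lborel (\<lambda>x. (norm (f x + g x))\<^sup>2)"
  proof (rule Bochner_Integration.integrable_bound)
    show "integrable lborel (\<lambda>x. 2 * (norm (f x))\<^sup>2 + 2 * (norm (g x))\<^sup>2)"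
      using square_integrable_integrable[OF f] square_integrable_integrable[OF g] by simp
    show "AE x in lborel. norm ((norm (f x + g x))\<^sup>2)
        \<le> norm (2 * (norm (f x))\<^sup>2 + 2 * (norm (g x))\<^sup>2)"
      using norm_add_power2_le_2 by (auto intro!: AE_I2)
  qed measurable
  then show ?thesis by (simp add: square_integrable_def)
qed

section \<open>Monotonicity, scaling and triangle inequality of the L2 norm\<close>

lemma l2_norm_nonneg [simp]: "l2_norm f \<ge> 0"
  by (simp add: l2_norm_def)

lemma l2_norm_mono:
  fixes f g :: "real ^ 'n \<Rightarrow> complex"
  assumes g: "square_integrable g" and f: "f \<in> borel_measurable borel" and "C \<ge> 0"
    and le: "AE x in lborel. norm (f x) \<le> C * norm (g x)"
  shows "l2_norm f \<le> C * l2_norm g"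
proof -
  have "(LINT x|lborel. (norm (f x))\<^sup>2) \<le> (LINT x|lborel. C\<^sup>2 * (norm (g x))\<^sup>2)"
  proof (rule integral_mono_AE)
    show "integrable lborel (\<lambda>x. (norm (f x))\<^sup>2)"
      by (rule square_integrable_integrable[OF square_integrable_bound[OF g f le]])
    show "integrable lborel (\<lambda>x. C\<^sup>2 * (norm (g x))\<^sup>2)"
      using square_integrable_integrable[OF g] by simp
    show "AE x in lborel. (norm (f x))\<^sup>2 \<le> C\<^sup>2 * (norm (g x))\<^sup>2"
      using le
    proof eventually_elim
      case (elim x)
      have "(norm (f x))\<^sup>2 \<le> (C * norm (g x))\<^sup>2"
        by (intro power_mono elim) auto
      then show ?case by (simp add: power_mult_distrib)
    qed
  qed
  then have "l2_norm f \<le> sqrt (C\<^sup>2 * (LINT x|lborel. (norm (g x))\<^sup>2))"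
    unfolding l2_norm_def by (intro real_sqrt_le_mono) simp
  also have "\<dots> = C * l2_norm g"
    using \<open>C \<ge> 0\<close> by (simp add: l2_norm_def real_sqrt_mult)
  finally show ?thesis .
qed

lemma l2_norm_cong_AE:
  fixes f g :: "real ^ 'n \<Rightarrow> complex"
  assumes "f \<in> borel_measurable borel" "g \<in> borel_measurable borel"
    and "AE x in lborel. f x = g x"
  shows "l2_norm f = l2_norm g"
proof -
  have "(LINT x|lborel. (norm (f x))\<^sup>2) = (LINT x|lborel. (norm (g x))\<^sup>2)"
    using assms by (intro integral_cong_AE) (auto elim!: eventually_mono)
  then show ?thesis by (simp add: l2_norm_def)
qed

lemma l2_norm_scale:
  fixes f :: "real ^ 'n \<Rightarrow> complex"
  shows "l2_norm (\<lambda>x. a * f x) = norm a * l2_norm f"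
  by (simp add: l2_norm_def norm_mult power_mult_distrib real_sqrt_mult)

text \<open>Minkowski's inequality, by integrating Young's inequality and choosing the weight e = b
  / a.\<close>

lemma l2_norm_triangle:
  fixes f g :: "real ^ 'n \<Rightarrow> complex"
  assumes f: "square_integrable f" and g: "square_integrable g"
  shows "l2_norm (\<lambda>x. f x + g x) \<le> l2_norm f + l2_norm g"
proof -
  define a b where "a = l2_norm f" and "b = l2_norm g"
  define I where "I = (LINT x|lborel. (norm (f x + g x))\<^sup>2)"
  have a: "a \<ge> 0" "a\<^sup>2 = (LINT x|lborel. (norm (f x))\<^sup>2)"
    and b: "b \<ge> 0" "b\<^sup>2 = (LINT x|lborel. (norm (g x))\<^sup>2)"
    by (simp_all add: a_def b_def l2_norm_def)
  have *: "I \<le> (1 + e) * a\<^sup>2 + (1 + 1 / e) * b\<^sup>2" if "e > 0" for e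
  proof -
    have "I \<le> (LINT x|lborel. (1 + e) * (norm (f x))\<^sup>2 + (1 + 1 / e) * (norm (g x))\<^sup>2)"
      unfolding I_def using that f g square_integrable_add[OF f g]
      by (intro integral_mono norm_add_power2_le Bochner_Integration.integrable_add
          integrable_mult_right square_integrable_integrable)
    also have "\<dots> = (1 + e) * a\<^sup>2 + (1 + 1 / e) * b\<^sup>2"
      using f g by (simp add: a b square_integrable_integrable)
    finally show ?thesis .
  qed
  \<comment> \<open>Either norm may vanish, so both are raised by d / 2 before the quotient e = b' /
    a' is formed. With a', b' in place of a, b the right-hand side is then the square of a' +
    b'.\<close>
  have "I \<le> (a + b + d)\<^sup>2" if "d > 0" for d
  proof -
    define a' b' where "a' = a + d / 2" and "b' = b + d / 2"
    have pos: "a' > 0" "b' > 0" using a b that by (auto simp: a'_def b'_def)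
    have "I \<le> (1 + b' / a') * a\<^sup>2 + (1 + 1 / (b' / a')) * b\<^sup>2"
      using pos by (intro *) simp
    also have "\<dots> \<le> (1 + b' / a') * a'\<^sup>2 + (1 + 1 / (b' / a')) * b'\<^sup>2"
      using pos a b that
      by (intro add_mono mult_left_mono power_mono) (auto simp: a'_def b'_def)
    also have "\<dots> = (a' + b')\<^sup>2"
      using pos by (simp add: field_simps power2_eq_square)
    finally show ?thesis by (simp add: a'_def b'_def algebra_simps)
  qed
  then have "sqrt I \<le> a + b + d" if "d > 0" for d
    using that a b by (intro real_le_lsqrt) auto
  then have "sqrt I \<le> a + b"
    by (rule field_le_epsilon)
  then show ?thesis by (simp add: l2_norm_def a_def b_def I_def)
qed

lemma square_integrable_diff:
  fixes f g :: "real ^ 'n \<Rightarrow> complex"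
  assumes "square_integrable f" "square_integrable g"
  shows "square_integrable (\<lambda>x. f x - g x)"
  using square_integrable_add[OF assms(1) square_integrable_scale[OF assms(2), of "-1"]] by simp

lemma l2_norm_eq_0_imp_AE:
  fixes f :: "real ^ 'n \<Rightarrow> complex"
  assumes f: "square_integrable f" and "l2_norm f = 0"
  shows "AE x in lborel. f x = 0"
proof -
  have "(LINT x|lborel. (norm (f x))\<^sup>2) = 0"
    using assms(2) by (simp add: l2_norm_def)
  then have "AE x in lborel. (norm (f x))\<^sup>2 = 0"
    by (subst integral_nonneg_eq_0_iff_AE[symmetric])
      (auto simp: square_integrable_integrable[OF f])
  then show ?thesis by simp
qed

section \<open>Truncated Fourier integrals\<close>

lemma borel_measurable_fourier_integrand:
  fixes f :: "real ^ 'n \<Rightarrow> complex"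
  assumes [measurable]: "f \<in> borel_measurable borel"
  shows "(\<lambda>x. indicat_real (cball 0 R) x *\<^sub>R (exp (- (\<i> * complex_of_real (x \<bullet> \<xi>))) * f x))
    \<in> borel_measurable borel"
  by (intro borel_measurable_scaleR borel_measurable_indicator) (auto intro: borel_closed)

text \<open>A ball has finite measure and |f| \<le> 1 + |f|^2, so an L2 function is integrable
  there. This makes the truncated transform additive.\<close>

lemma square_integrable_set_integrable:
  fixes f :: "real ^ 'n \<Rightarrow> complex"
  assumes f: "square_integrable f"
  shows "set_integrable lborel (cball 0 R) (\<lambda>x. exp (- \<i> * complex_of_real (x \<bullet> \<xi>)) * f x)"
  unfolding set_integrable_def
proof (rule Bochner_Integration.integrable_bound)
  note [measurable] = square_integrable_measurable[OF f]
  have "integrable lborel (indicat_real (cball 0 R :: (real ^ 'n) set))"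
    using emeasure_lborel_cball_finite[of "0 :: real ^ 'n" R]
    by (intro integrable_real_indicator) (auto simp: top.not_eq_extremum)
  then show "integrable lborel (\<lambda>x. indicat_real (cball 0 R) x + (norm (f x))\<^sup>2)"
    using square_integrable_integrable[OF f] by (rule Bochner_Integration.integrable_add)
  show "(\<lambda>x. indicat_real (cball 0 R) x *\<^sub>R (exp (- \<i> * complex_of_real (x \<bullet> \<xi>)) * f x))
      \<in> borel_measurable lborel"
    by (simp add: borel_measurable_fourier_integrand)
  have *: "y \<le> 1 + y\<^sup>2" for y :: real
    using zero_le_power2[of "y - 1 / 2"]
    by (simp add: power2_eq_square algebra_simps)
  show "AE x in lborel.
      norm (indicat_real (cball 0 R) x *\<^sub>R (exp (- \<i> * complex_of_real (x \<bullet> \<xi>)) * f x))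
        \<le> norm (indicat_real (cball 0 R) x + (norm (f x))\<^sup>2)"
    using * by (auto intro!: AE_I2 simp: norm_mult indicator_def)
qed

lemma truncated_fourier_measurable [measurable]:
  fixes f :: "real ^ 'n \<Rightarrow> complex"
  assumes [measurable]: "f \<in> borel_measurable borel"
  shows "truncated_fourier f N \<in> borel_measurable borel"
proof -
  have [measurable]: "f \<in> borel_measurable lborel" by simp
  \<comment> \<open>Written as a condition on \<open>norm x\<close>, the cut-off lets
    \<open>measurable\<close> see the integrand as jointly measurable in x and \<xi>.\<close>
  have "indicat_real (cball 0 (real N)) x = (if norm x \<le> real N then 1 else 0)" for x :: "real ^ 'n"
    by (simp add: indicator_def)
  moreover have "(\<lambda>\<xi>. LINT x|lborel. (if norm x \<le> real N then 1 else 0) *\<^sub>R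
      (exp (- \<i> * complex_of_real (x \<bullet> \<xi>)) * f x)) \<in> borel_measurable borel"
    by measurable
  ultimately have "(\<lambda>\<xi>. LINT x|lborel. indicat_real (cball 0 (real N)) x *\<^sub>R
      (exp (- \<i> * complex_of_real (x \<bullet> \<xi>)) * f x)) \<in> borel_measurable borel"
    by simp
  then show ?thesis
    unfolding truncated_fourier_def set_lebesgue_integral_def by measurable
qed

lemma truncated_fourier_add:
  fixes f g :: "real ^ 'n \<Rightarrow> complex"
  assumes "square_integrable f" "square_integrable g"
  shows "truncated_fourier (\<lambda>x. f x + g x) N \<xi> = truncated_fourier f N \<xi> + truncated_fourier g N \<xi>"
  unfolding truncated_fourier_def distrib_left
    set_integral_add(2)[OF assms[THEN square_integrable_set_integrable]] ..

lemma truncated_fourier_scale: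
  fixes f :: "real ^ 'n \<Rightarrow> complex"
  shows "truncated_fourier (\<lambda>x. a * f x) N \<xi> = a * truncated_fourier f N \<xi>"
proof -
  have "(LINT x:cball 0 (real N)|lborel. exp (- \<i> * complex_of_real (x \<bullet> \<xi>)) * (a * f x))
      = a * (LINT x:cball 0 (real N)|lborel. exp (- \<i> * complex_of_real (x \<bullet> \<xi>)) * f x)"
    by (subst set_integral_mult_right[symmetric]) (simp add: ac_simps)
  then show ?thesis by (simp add: truncated_fourier_def ac_simps)
qed

lemma truncated_fourier_cong_AE:
  fixes f g :: "real ^ 'n \<Rightarrow> complex"
  assumes [measurable]: "f \<in> borel_measurable borel" "g \<in> borel_measurable borel"
    and eq: "AE x in lborel. f x = g x"
  shows "truncated_fourier f N = truncated_fourier g N"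
proof
  fix \<xi>
  have "(LINT x:cball 0 (real N)|lborel. exp (- \<i> * complex_of_real (x \<bullet> \<xi>)) * f x)
      = (LINT x:cball 0 (real N)|lborel. exp (- \<i> * complex_of_real (x \<bullet> \<xi>)) * g x)"
    unfolding set_lebesgue_integral_def
  proof (rule integral_cong_AE)
    show "AE x in lborel. indicat_real (cball 0 (real N)) x *\<^sub>R (exp (- \<i> * complex_of_real (x \<bullet> \<xi>)) * f x)
        = indicat_real (cball 0 (real N)) x *\<^sub>R (exp (- \<i> * complex_of_real (x \<bullet> \<xi>)) * g x)"
      using eq by eventually_elim simp
  qed (simp_all add: borel_measurable_fourier_integrand)
  then show "truncated_fourier f N \<xi> = truncated_fourier g N \<xi>"
    by (simp add: truncated_fourier_def)
qed

section \<open>Linearity and uniqueness of the Fourier--Plancherel relation\<close>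

lemma has_fourier_square_integrable:
  assumes "has_fourier f g"
  shows "square_integrable f" "square_integrable g"
  using assms by (auto simp: has_fourier_def)

lemma has_fourier_measurable:
  assumes "has_fourier f g"
  shows "f \<in> borel_measurable borel" "g \<in> borel_measurable borel"
  using has_fourier_square_integrable[OF assms] by auto

text \<open>Both arguments stand for classes modulo null sets: changing f on a null set leaves every
  truncated transform unchanged, changing g leaves the distance integrals unchanged.\<close>

lemma has_fourier_cong_AE:
  fixes f f' g g' :: "real ^ 'n \<Rightarrow> complex"
  assumes fg: "has_fourier f g"
    and [measurable]: "f' \<in> borel_measurable borel" "g' \<in> borel_measurable borel"
    and f: "AE x in lborel. f x = f' x" and g: "AE \<xi> in lborel. g \<xi> = g' \<xi>"
  shows "has_fourier f' g'"
proof -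
  note [measurable] = has_fourier_measurable[OF fg]
  have "square_integrable f'"
    using f by (intro square_integrable_bound[OF has_fourier_square_integrable(1)[OF fg], where C = 1])
      (auto elim!: eventually_mono)
  moreover have "square_integrable g'"
    using g by (intro square_integrable_bound[OF has_fourier_square_integrable(2)[OF fg], where C = 1])
      (auto elim!: eventually_mono)
  moreover have "truncated_fourier f = truncated_fourier f'"
    using f by (intro ext truncated_fourier_cong_AE[THEN fun_cong]) auto
  moreover have "(\<integral>\<^sup>+ \<xi>. ennreal ((norm (g \<xi> - truncated_fourier f N \<xi>))\<^sup>2) \<partial>lborel)
      = (\<integral>\<^sup>+ \<xi>. ennreal ((norm (g' \<xi> - truncated_fourier f N \<xi>))\<^sup>2) \<partial>lborel)" for N
    using g by (intro nn_integral_cong_AE) (auto elim!: eventually_mono)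
  ultimately show ?thesis using fg by (simp add: has_fourier_def)
qed

lemma has_fourier_scale:
  fixes f g :: "real ^ 'n \<Rightarrow> complex"
  assumes fg: "has_fourier f g"
  shows "has_fourier (\<lambda>x. a * f x) (\<lambda>\<xi>. a * g \<xi>)"
proof -
  note [measurable] = has_fourier_measurable[OF fg]
  have "(\<integral>\<^sup>+ \<xi>. ennreal ((norm (a * g \<xi> - truncated_fourier (\<lambda>x. a * f x) N \<xi>))\<^sup>2) \<partial>lborel)
      = ennreal ((norm a)\<^sup>2) * (\<integral>\<^sup>+ \<xi>. ennreal ((norm (g \<xi> - truncated_fourier f N \<xi>))\<^sup>2) \<partial>lborel)"
    for N
    by (subst nn_integral_cmult[symmetric])
      (auto simp: truncated_fourier_scale norm_mult power_mult_distrib ennreal_mult'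
        simp flip: right_diff_distrib)
  moreover have "(\<lambda>N. ennreal ((norm a)\<^sup>2) *
      (\<integral>\<^sup>+ \<xi>. ennreal ((norm (g \<xi> - truncated_fourier f N \<xi>))\<^sup>2) \<partial>lborel)) \<longlonglongrightarrow> ennreal ((norm a)\<^sup>2) * 0"
    using fg by (intro ennreal_tendsto_cmult) (auto simp: has_fourier_def)
  ultimately show ?thesis
    using has_fourier_square_integrable[OF fg] by (simp add: has_fourier_def square_integrable_scale)
qed

text \<open>The factor 2 is harmless for null sequences. Nonnegative integrals keep the bound
  meaningful even where a difference from a truncated transform is not square integrable.\<close>

lemma nn_integral_norm_add_power2_le:
  fixes f g :: "real ^ 'n \<Rightarrow> complex"
  assumes [measurable]: "f \<in> borel_measurable borel" "g \<in> borel_measurable borel"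
  shows "(\<integral>\<^sup>+ \<xi>. ennreal ((norm (f \<xi> + g \<xi>))\<^sup>2) \<partial>lborel)
    \<le> 2 * (\<integral>\<^sup>+ \<xi>. ennreal ((norm (f \<xi>))\<^sup>2) \<partial>lborel) + 2 * (\<integral>\<^sup>+ \<xi>. ennreal ((norm (g \<xi>))\<^sup>2) \<partial>lborel)"
proof -
  have "(\<integral>\<^sup>+ \<xi>. ennreal ((norm (f \<xi> + g \<xi>))\<^sup>2) \<partial>lborel)
      \<le> (\<integral>\<^sup>+ \<xi>. 2 * ennreal ((norm (f \<xi>))\<^sup>2) + 2 * ennreal ((norm (g \<xi>))\<^sup>2) \<partial>lborel)"
  proof (rule nn_integral_mono)
    fix \<xi>
    have "ennreal ((norm (f \<xi> + g \<xi>))\<^sup>2) \<le> ennreal (2 * (norm (f \<xi>))\<^sup>2 + 2 * (norm (g \<xi>))\<^sup>2)"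
      by (intro ennreal_leI norm_add_power2_le_2)
    then show "ennreal ((norm (f \<xi> + g \<xi>))\<^sup>2) \<le> 2 * ennreal ((norm (f \<xi>))\<^sup>2) + 2 * ennreal ((norm (g \<xi>))\<^sup>2)"
      by (simp add: ennreal_plus ennreal_mult')
  qed
  also have "\<dots> = 2 * (\<integral>\<^sup>+ \<xi>. ennreal ((norm (f \<xi>))\<^sup>2) \<partial>lborel)
      + 2 * (\<integral>\<^sup>+ \<xi>. ennreal ((norm (g \<xi>))\<^sup>2) \<partial>lborel)"
    by (simp add: nn_integral_add nn_integral_cmult)
  finally show ?thesis .
qed

lemma tendsto_zero_ennreal_2_add:
  fixes u v w :: "nat \<Rightarrow> ennreal"
  assumes "u \<longlonglongrightarrow> 0" "v \<longlonglongrightarrow> 0" and le: "\<And>N. w N \<le> 2 * u N + 2 * v N"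
  shows "w \<longlonglongrightarrow> 0"
proof -
  have "(\<lambda>N. 2 * u N + 2 * v N) \<longlonglongrightarrow> 2 * 0 + 2 * 0"
    using assms by (intro tendsto_add ennreal_tendsto_cmult) auto
  then show ?thesis
    by (intro tendsto_sandwich[of "\<lambda>_. 0" w sequentially "\<lambda>N. 2 * u N + 2 * v N" 0]) (auto simp: le)
qed

lemma has_fourier_add:
  fixes f g f' g' :: "real ^ 'n \<Rightarrow> complex"
  assumes fg: "has_fourier f g" and fg': "has_fourier f' g'"
  shows "has_fourier (\<lambda>x. f x + f' x) (\<lambda>\<xi>. g \<xi> + g' \<xi>)"
proof -
  note [measurable] = has_fourier_measurable[OF fg] has_fourier_measurable[OF fg']
  note si = has_fourier_square_integrable[OF fg] has_fourier_square_integrable[OF fg']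
  have "(\<integral>\<^sup>+ \<xi>. ennreal ((norm (g \<xi> + g' \<xi> - truncated_fourier (\<lambda>x. f x + f' x) N \<xi>))\<^sup>2) \<partial>lborel)
      \<le> 2 * (\<integral>\<^sup>+ \<xi>. ennreal ((norm (g \<xi> - truncated_fourier f N \<xi>))\<^sup>2) \<partial>lborel)
        + 2 * (\<integral>\<^sup>+ \<xi>. ennreal ((norm (g' \<xi> - truncated_fourier f' N \<xi>))\<^sup>2) \<partial>lborel)" for N
    using nn_integral_norm_add_power2_le[of "\<lambda>\<xi>. g \<xi> - truncated_fourier f N \<xi>"
        "\<lambda>\<xi>. g' \<xi> - truncated_fourier f' N \<xi>"]
    by (simp add: truncated_fourier_add[OF si(1,3)] algebra_simps)
  then have "(\<lambda>N. \<integral>\<^sup>+ \<xi>. ennreal ((norm (g \<xi> + g' \<xi> - truncated_fourier (\<lambda>x. f x + f' x) N \<xi>))\<^sup>2)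
      \<partial>lborel) \<longlonglongrightarrow> 0"
    using fg fg' unfolding has_fourier_def by (blast intro: tendsto_zero_ennreal_2_add)
  then show ?thesis
    using si by (simp add: has_fourier_def square_integrable_add)
qed

lemma has_fourier_diff:
  fixes f g f' g' :: "real ^ 'n \<Rightarrow> complex"
  assumes "has_fourier f g" "has_fourier f' g'"
  shows "has_fourier (\<lambda>x. f x - f' x) (\<lambda>\<xi>. g \<xi> - g' \<xi>)"
  using has_fourier_add[OF assms(1) has_fourier_scale[OF assms(2), of "-1"]] by simp

lemma has_fourier_zero: "has_fourier (\<lambda>x. 0) (\<lambda>\<xi>. 0)"
  by (simp add: has_fourier_def square_integrable_def truncated_fourier_def)

lemma has_fourier_sum:
  fixes f g :: "'i \<Rightarrow> real ^ 'n \<Rightarrow> complex"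
  assumes "\<And>i. i \<in> I \<Longrightarrow> has_fourier (f i) (g i)"
  shows "has_fourier (\<lambda>x. \<Sum>i\<in>I. f i x) (\<lambda>\<xi>. \<Sum>i\<in>I. g i \<xi>)"
  using assms
  by (induction I rule: infinite_finite_induct) (auto intro: has_fourier_zero has_fourier_add)

text \<open>The distance of g and g' does not depend on N, yet the common truncated transforms bound
  it by a null sequence; hence it is 0.\<close>

lemma has_fourier_unique:
  fixes f g g' :: "real ^ 'n \<Rightarrow> complex"
  assumes fg: "has_fourier f g" and fg': "has_fourier f g'"
  shows "AE \<xi> in lborel. g \<xi> = g' \<xi>"
proof -
  note [measurable] = has_fourier_measurable[OF fg] has_fourier_measurable[OF fg']
  let ?I = "\<integral>\<^sup>+ \<xi>. ennreal ((norm (g \<xi> - g' \<xi>))\<^sup>2) \<partial>lborel"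
  have "?I \<le> 2 * (\<integral>\<^sup>+ \<xi>. ennreal ((norm (g \<xi> - truncated_fourier f N \<xi>))\<^sup>2) \<partial>lborel)
        + 2 * (\<integral>\<^sup>+ \<xi>. ennreal ((norm (g' \<xi> - truncated_fourier f N \<xi>))\<^sup>2) \<partial>lborel)" for N
    using nn_integral_norm_add_power2_le[of "\<lambda>\<xi>. g \<xi> - truncated_fourier f N \<xi>"
        "\<lambda>\<xi>. truncated_fourier f N \<xi> - g' \<xi>"]
    by (simp add: norm_minus_commute)
  then have "(\<lambda>N. ?I) \<longlonglongrightarrow> 0"
    using fg fg' unfolding has_fourier_def by (blast intro: tendsto_zero_ennreal_2_add)
  then have "?I = 0"
    by (simp add: tendsto_const_iff)
  then show ?thesis
    by (subst (asm) nn_integral_0_iff_AE) (auto elim!: eventually_mono)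
qed

section \<open>The chosen transform and the Sobolev norms\<close>

lemma has_fourier_fourier: "has_fourier f g \<Longrightarrow> has_fourier f (fourier f)"
  unfolding fourier_def by (metis someI)

text \<open>The transform selected by \<open>SOME\<close> agrees almost everywhere with any other
  one, so the norm can be computed from an explicit transform.\<close>

lemma sobolev_norm_eq:
  fixes f g :: "real ^ 'n \<Rightarrow> complex"
  assumes "has_fourier f g"
  shows "sobolev_norm s f = l2_norm (\<lambda>\<xi>. complex_of_real ((1 + (norm \<xi>)\<^sup>2) powr (s / 2)) * g \<xi>)"
proof -
  note F = has_fourier_fourier[OF assms]
  note [measurable] = has_fourier_measurable[OF assms] has_fourier_measurable[OF F]
  have "sobolev_norm s f = l2_norm (\<lambda>\<xi>. complex_of_real ((1 + (norm \<xi>)\<^sup>2) powr (s / 2)) * fourier f \<xi>)"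
    by (simp add: sobolev_norm_def l2_norm_def)
  also have "\<dots> = l2_norm (\<lambda>\<xi>. complex_of_real ((1 + (norm \<xi>)\<^sup>2) powr (s / 2)) * g \<xi>)"
    using has_fourier_unique[OF F assms]
    by (intro l2_norm_cong_AE) (auto elim!: eventually_mono)
  finally show ?thesis .
qed

lemma sobolev_norm_0_eq:
  fixes f g :: "real ^ 'n \<Rightarrow> complex"
  assumes "has_fourier f g"
  shows "sobolev_norm 0 f = l2_norm g"
proof -
  \<comment> \<open>In HOL \<open>0 powr 0 = 0\<close>, so the weight of order 0 is 1 only because
    its base is nonzero.\<close>
  have "1 + (norm \<xi>)\<^sup>2 \<noteq> 0" for \<xi> :: "real ^ 'n"
    by (smt (verit) zero_le_power2)
  then show ?thesis by (simp add: sobolev_norm_eq[OF assms])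
qed

section \<open>Symbols of the operators\<close>

text \<open>The graph provides some transform of f; uniqueness exchanges it for the prescribed g.
  All operators can then act on one fixed transform.\<close>

lemma fourier_multiplier_has_fourier:
  fixes m :: "real ^ 'n \<Rightarrow> complex"
  assumes "fourier_multiplier m f h" and fg: "has_fourier f g"
    and [measurable]: "m \<in> borel_measurable borel"
  shows "has_fourier h (\<lambda>\<xi>. m \<xi> * g \<xi>)"
proof -
  obtain g' where g': "has_fourier f g'" "has_fourier h (\<lambda>\<xi>. m \<xi> * g' \<xi>)"
    using assms(1) by (auto simp: fourier_multiplier_def)
  note [measurable] = has_fourier_measurable[OF fg] has_fourier_measurable[OF g'(1)]
    has_fourier_measurable[OF g'(2)]
  show ?thesis
    using has_fourier_unique[OF g'(1) fg]
    by (intro has_fourier_cong_AE[OF g'(2)]) (auto elim!: eventually_mono)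
qed

lemma fourier_multiplier_funpow_has_fourier:
  fixes m :: "real ^ 'n \<Rightarrow> complex"
  assumes "(fourier_multiplier m ^^ j) f h" and fg: "has_fourier f g"
    and m: "m \<in> borel_measurable borel"
  shows "has_fourier h (\<lambda>\<xi>. m \<xi> ^ j * g \<xi>)"
  using assms(1)
proof (induction j arbitrary: h)
  case 0
  then show ?case using fg by simp
next
  case (Suc j)
  then obtain h' where "(fourier_multiplier m ^^ j) f h'" "fourier_multiplier m h' h"
    by auto
  then show ?case
    using fourier_multiplier_has_fourier[OF _ Suc.IH m] by (simp add: mult.assoc)
qed

text \<open>Both symbols are kept as real functions: the propagators exp (i t m) then have modulus
  one.\<close>

definition klein_gordon_symbol :: "real \<Rightarrow> real ^ 'n \<Rightarrow> real" where
  "klein_gordon_symbol c \<xi> = c * sqrt (c\<^sup>2 + (norm \<xi>)\<^sup>2)"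

definition normal_form_symbol :: "nat \<Rightarrow> real \<Rightarrow> real ^ 'n \<Rightarrow> real" where
  "normal_form_symbol r c \<xi> =
     c\<^sup>2 + (\<Sum>j=1..r. nf_coeff j / c ^ (2 * (j - 1)) * (- (norm \<xi>)\<^sup>2) ^ j)"

lemma klein_gordon_symbol_measurable [measurable]:
  "klein_gordon_symbol c \<in> borel_measurable borel"
  unfolding klein_gordon_symbol_def by measurable

lemma normal_form_symbol_measurable [measurable]:
  "normal_form_symbol r c \<in> borel_measurable borel"
  unfolding normal_form_symbol_def by measurable

lemma klein_gordon_operator_has_fourier:
  fixes f :: "real ^ 'n \<Rightarrow> complex"
  assumes "klein_gordon_operator c f v" and "has_fourier f g"
  shows "has_fourier v (\<lambda>\<xi>. complex_of_real (klein_gordon_symbol c \<xi>) * g \<xi>)"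
proof -
  obtain h where "bracket_nabla c f h" and v: "v = (\<lambda>x. complex_of_real c * h x)"
    using assms(1) by (auto simp: klein_gordon_operator_def)
  then have "has_fourier h (\<lambda>\<xi>. complex_of_real (sqrt (c\<^sup>2 + (norm \<xi>)\<^sup>2)) * g \<xi>)"
    unfolding bracket_nabla_def
    by (intro fourier_multiplier_has_fourier[OF _ assms(2)]) auto
  from has_fourier_scale[OF this, of "complex_of_real c"] show ?thesis
    by (simp add: v klein_gordon_symbol_def mult.assoc)
qed

lemma normal_form_operator_has_fourier:
  fixes f :: "real ^ 'n \<Rightarrow> complex"
  assumes "normal_form_operator r c f v" and fg: "has_fourier f g"
  shows "has_fourier v (\<lambda>\<xi>. complex_of_real (normal_form_symbol r c \<xi>) * g \<xi>)"
proof -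
  obtain h where h: "\<And>j. j \<in> {1..r} \<Longrightarrow> (laplacian ^^ j) f (h j)"
    and v: "v = (\<lambda>x. complex_of_real (c\<^sup>2) * f x +
                 (\<Sum>j=1..r. complex_of_real (nf_coeff j / c ^ (2 * (j - 1))) * h j x))"
    using assms(1) unfolding normal_form_operator_def by blast
  have hj: "has_fourier (h j) (\<lambda>\<xi>. complex_of_real (- (norm \<xi>)\<^sup>2) ^ j * g \<xi>)" if "j \<in> {1..r}" for j
    using h[OF that] unfolding laplacian_def
    by (rule fourier_multiplier_funpow_has_fourier[OF _ fg]) simp
  have "has_fourier v (\<lambda>\<xi>. complex_of_real (c\<^sup>2) * g \<xi> +
      (\<Sum>j=1..r. complex_of_real (nf_coeff j / c ^ (2 * (j - 1))) *
        (complex_of_real (- (norm \<xi>)\<^sup>2) ^ j * g \<xi>)))"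
    unfolding v by (intro has_fourier_add has_fourier_sum has_fourier_scale hj fg)
  also have "(\<lambda>\<xi>. complex_of_real (c\<^sup>2) * g \<xi> +
      (\<Sum>j=1..r. complex_of_real (nf_coeff j / c ^ (2 * (j - 1))) *
        (complex_of_real (- (norm \<xi>)\<^sup>2) ^ j * g \<xi>)))
      = (\<lambda>\<xi>. complex_of_real (normal_form_symbol r c \<xi>) * g \<xi>)"
    by (simp add: normal_form_symbol_def distrib_right sum_distrib_right mult.assoc)
  finally show ?thesis .
qed

section \<open>Estimates for unimodular exponentials\<close>

text \<open>Second-order Taylor remainder on the imaginary axis, where the factor
  \<open>exp \<bar>Re z\<bar>\<close> is 1. \<open>Taylor_exp\<close> divides by
  \<open>fact 1\<close>, hence x^2 and not x^2 / 2.\<close>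

lemma norm_exp_i_minus_1_minus_linear:
  fixes x :: real
  shows "norm (exp (\<i> * complex_of_real x) - 1 - \<i> * complex_of_real x) \<le> x\<^sup>2"
proof -
  have "norm (exp (\<i> * complex_of_real x) - (\<Sum>k\<le>1. (\<i> * complex_of_real x) ^ k / fact k))
      \<le> exp \<bar>Re (\<i> * complex_of_real x)\<bar> * norm (\<i> * complex_of_real x) ^ Suc 1 / fact 1"
    by (rule Taylor_exp)
  then show ?thesis by (simp add: norm_mult power2_eq_square diff_diff_eq)
qed

text \<open>Splitting off a unimodular factor leaves the Taylor bound of order zero. It turns a
  phase error into an error of the propagators.\<close>

lemma norm_exp_i_diff_le:
  fixes x y :: real
  shows "norm (exp (\<i> * complex_of_real x) - exp (\<i> * complex_of_real y)) \<le> \<bar>x - y\<bar>"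
proof -
  have "exp (\<i> * complex_of_real x) - exp (\<i> * complex_of_real y)
      = exp (\<i> * complex_of_real y) * (exp (\<i> * complex_of_real (x - y)) - 1)"
    by (simp add: algebra_simps flip: exp_add)
  then have "norm (exp (\<i> * complex_of_real x) - exp (\<i> * complex_of_real y))
      = norm (exp (\<i> * complex_of_real (x - y)) - 1)"
    by (simp only: norm_mult norm_exp_i_times mult_1)
  also have "\<dots> \<le> \<bar>x - y\<bar>"
    using Taylor_exp[of "\<i> * complex_of_real (x - y)" 0] by (simp add: norm_mult flip: of_real_diff)
  finally show ?thesis .
qed

section \<open>Strong solutions on the Fourier side\<close>

text \<open>For w = U(s) and z = U(t) this bounds the increment of exp (-i t m) U(t): the first term
  is |s - t| times the error of the difference quotient, the second is quadratic in s - t.\<close>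

lemma propagator_increment_le:
  fixes s t m :: real and z w :: complex
  assumes "\<bar>m\<bar> \<le> M"
  shows "norm (exp (- \<i> * of_real (s * m)) * w - exp (- \<i> * of_real (t * m)) * z)
    \<le> norm (w - z - of_real (s - t) * (\<i> * of_real m * z)) + ((s - t) * M)\<^sup>2 * norm z"
proof -
  let ?E = "exp (- \<i> * complex_of_real (s * m))" and ?h = "complex_of_real ((s - t) * m)"
  have E: "norm ?E = 1"
    using norm_exp_i_times[of "- (s * m)"] by simp
  \<comment> \<open>Pulling out the factor at time s leaves the relative phase h = (s - t) m; adding
    and subtracting i h z separates the equation from the Taylor remainder.\<close>
  have "exp (- \<i> * of_real (t * m)) = ?E * exp (\<i> * ?h)"
    by (simp add: algebra_simps flip: exp_add)
  then have "?E * w - exp (- \<i> * of_real (t * m)) * z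
      = ?E * ((w - z - of_real (s - t) * (\<i> * of_real m * z)) - (exp (\<i> * ?h) - 1 - \<i> * ?h) * z)"
    by (simp add: algebra_simps)
  then have "norm (?E * w - exp (- \<i> * of_real (t * m)) * z)
      = norm ((w - z - of_real (s - t) * (\<i> * of_real m * z)) - (exp (\<i> * ?h) - 1 - \<i> * ?h) * z)"
    by (simp only: norm_mult E mult_1)
  also have "\<dots> \<le> norm (w - z - of_real (s - t) * (\<i> * of_real m * z))
      + norm (exp (\<i> * ?h) - 1 - \<i> * ?h) * norm z"
    unfolding norm_mult[symmetric] by (rule norm_triangle_ineq4)
  also have "\<dots> \<le> norm (w - z - of_real (s - t) * (\<i> * of_real m * z)) + ((s - t) * M)\<^sup>2 * norm z"
  proof (intro add_mono mult_right_mono order_refl)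
    have "((s - t) * m)\<^sup>2 \<le> ((s - t) * M)\<^sup>2"
      using assms by (simp add: power_mult_distrib mult_left_mono abs_le_square_iff[symmetric])
    then show "norm (exp (\<i> * ?h) - 1 - \<i> * ?h) \<le> ((s - t) * M)\<^sup>2"
      using norm_exp_i_minus_1_minus_linear order_trans by blast
  qed simp
  finally show ?thesis .
qed

text \<open>On the set where \<open>\<bar>m\<bar> \<le> M\<close> the function \<open>t \<mapsto> e\<^sup>-\<^sup>i\<^sup>t\<^sup>m U(t)\<close> has derivative zero in \<open>L\<^sup>2\<close>,
  so its distance to \<open>U(0)\<close> is a real function with derivative zero.\<close>

lemma l2_evolution_unique:
  fixes U :: "real \<Rightarrow> real ^ 'n \<Rightarrow> complex" and m :: "real ^ 'n \<Rightarrow> real"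
  assumes U: "\<And>t. t \<ge> 0 \<Longrightarrow> square_integrable (U t)"
    and [measurable]: "m \<in> borel_measurable borel"
    and mU: "\<And>t. t \<ge> 0 \<Longrightarrow> square_integrable (\<lambda>\<xi>. complex_of_real (m \<xi>) * U t \<xi>)"
    and deriv: "\<And>t. t \<ge> 0 \<Longrightarrow>
      ((\<lambda>s. l2_norm (\<lambda>\<xi>. (U s \<xi> - U t \<xi>) / complex_of_real (s - t) - \<i> * complex_of_real (m \<xi>) * U t \<xi>))
        \<longlongrightarrow> 0) (at t within {0..})"
    and "t \<ge> 0"
  shows "AE \<xi> in lborel. U t \<xi> = exp (\<i> * complex_of_real (t * m \<xi>)) * U 0 \<xi>"
proof -
  have meas [measurable]: "U t \<in> borel_measurable borel" if "t \<ge> 0" for t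
    using U[OF that] by auto
  \<comment> \<open>The symbol may be unbounded; the cut-off bounds the quadratic remainder by ((s -
    t) M)^2 uniformly in \<xi>.\<close>
  have zero: "AE \<xi> in lborel. \<bar>m \<xi>\<bar> \<le> M \<longrightarrow> U t \<xi> = exp (\<i> * complex_of_real (t * m \<xi>)) * U 0 \<xi>"
    if "M \<ge> 0" for M
  proof -
    define D where "D t \<xi> = (if \<bar>m \<xi>\<bar> \<le> M then exp (- \<i> * complex_of_real (t * m \<xi>)) * U t \<xi> else 0)"
      for t \<xi>
    have D_meas [measurable]: "D t \<in> borel_measurable borel" if "t \<ge> 0" for t
    proof -
      note [measurable] = meas[OF that]
      show ?thesis unfolding D_def by measurable
    qed
    have D: "square_integrable (D t)" if "t \<ge> 0" for t
    proof (rule square_integrable_bound[OF U[OF that] D_meas[OF that], where C = 1])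
      show "AE \<xi> in lborel. norm (D t \<xi>) \<le> 1 * norm (U t \<xi>)"
        using norm_exp_i_times[of "- (t * m \<xi>)" for \<xi>] by (auto intro!: AE_I2 simp: D_def norm_mult)
    qed
    define N where "N t = l2_norm (\<lambda>\<xi>. D t \<xi> - D 0 \<xi>)" for t
    define R where "R s t \<xi> = (U s \<xi> - U t \<xi>) / complex_of_real (s - t) - \<i> * complex_of_real (m \<xi>) * U t \<xi>"
      for s t \<xi>
    have R: "square_integrable (R s t)" if "s \<ge> 0" "t \<ge> 0" for s t
      unfolding R_def
      using square_integrable_diff[OF square_integrable_scale[
            OF square_integrable_diff[OF U[OF that(1)] U[OF that(2)]],
            of "inverse (complex_of_real (s - t))"]
          square_integrable_scale[OF mU[OF that(2)], of \<i>]]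
      by (simp add: divide_inverse ac_simps)
    \<comment> \<open>Reverse triangle inequality, then the pointwise increment bound under the
      norm. The factor of |s - t| tends to 0 as s tends to t.\<close>
    have Lipschitz: "\<bar>N s - N t\<bar> \<le> \<bar>s - t\<bar> * (l2_norm (R s t) + \<bar>s - t\<bar> * (M\<^sup>2 * l2_norm (U t)))"
      if "s \<ge> 0" "t \<ge> 0" "s \<noteq> t" for s t
    proof -
      have dst: "square_integrable (\<lambda>\<xi>. D s \<xi> - D t \<xi>)" and ds0: "square_integrable (\<lambda>\<xi>. D s \<xi> - D 0 \<xi>)"
        and dt0: "square_integrable (\<lambda>\<xi>. D t \<xi> - D 0 \<xi>)" and dts: "square_integrable (\<lambda>\<xi>. D t \<xi> - D s \<xi>)"
        using that by (auto intro!: square_integrable_diff D)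
      have sym: "l2_norm (\<lambda>\<xi>. D t \<xi> - D s \<xi>) = l2_norm (\<lambda>\<xi>. D s \<xi> - D t \<xi>)"
        by (simp add: l2_norm_def norm_minus_commute)
      \<comment> \<open>\<open>l2_norm\<close> takes complex functions, so the real majorants |R|
        and |U| are embedded before scaling and the triangle inequality apply to them.\<close>
      have nR: "square_integrable (\<lambda>\<xi>. complex_of_real (norm (R s t \<xi>)))"
        using R[OF that(1,2)] square_integrable_measurable[OF R[OF that(1,2)]]
        by (simp add: square_integrable_def)
      have nU: "square_integrable (\<lambda>\<xi>. complex_of_real (norm (U t \<xi>)))"
        using U[OF that(2)] meas[OF that(2)]
        by (simp add: square_integrable_def)
      have "\<bar>N s - N t\<bar> \<le> l2_norm (\<lambda>\<xi>. D s \<xi> - D t \<xi>)"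
        using l2_norm_triangle[OF dst dt0] l2_norm_triangle[OF dts ds0] by (simp add: N_def sym abs_le_iff)
      also have "\<dots> \<le> 1 * l2_norm (\<lambda>\<xi>. complex_of_real \<bar>s - t\<bar> * complex_of_real (norm (R s t \<xi>))
          + complex_of_real (((s - t) * M)\<^sup>2) * complex_of_real (norm (U t \<xi>)))"
      proof (rule l2_norm_mono)
        show "square_integrable (\<lambda>\<xi>. complex_of_real \<bar>s - t\<bar> * complex_of_real (norm (R s t \<xi>))
            + complex_of_real (((s - t) * M)\<^sup>2) * complex_of_real (norm (U t \<xi>)))"
          by (intro square_integrable_add square_integrable_scale nR nU)
        show "(\<lambda>\<xi>. D s \<xi> - D t \<xi>) \<in> borel_measurable borel"
          using dst by auto
        show "AE \<xi> in lborel. norm (D s \<xi> - D t \<xi>)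
            \<le> 1 * norm (complex_of_real \<bar>s - t\<bar> * complex_of_real (norm (R s t \<xi>))
              + complex_of_real (((s - t) * M)\<^sup>2) * complex_of_real (norm (U t \<xi>)))"
        proof (rule AE_I2)
          fix \<xi>
          have "U s \<xi> - U t \<xi> - of_real (s - t) * (\<i> * of_real (m \<xi>) * U t \<xi>) = of_real (s - t) * R s t \<xi>"
            using that(3) by (simp add: R_def field_simps)
          then have "norm (U s \<xi> - U t \<xi> - of_real (s - t) * (\<i> * of_real (m \<xi>) * U t \<xi>)) = \<bar>s - t\<bar> * norm (R s t \<xi>)"
            by (simp only: norm_mult norm_of_real)
          then have "norm (D s \<xi> - D t \<xi>) \<le> \<bar>s - t\<bar> * norm (R s t \<xi>) + ((s - t) * M)\<^sup>2 * norm (U t \<xi>)"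
            using propagator_increment_le[of "m \<xi>" M s "U s \<xi>" t "U t \<xi>"] by (simp add: D_def)
          also have "\<dots> = norm (complex_of_real (\<bar>s - t\<bar> * norm (R s t \<xi>) + ((s - t) * M)\<^sup>2 * norm (U t \<xi>)))"
            by (simp only: norm_of_real) simp
          finally show "norm (D s \<xi> - D t \<xi>)
            \<le> 1 * norm (complex_of_real \<bar>s - t\<bar> * complex_of_real (norm (R s t \<xi>))
              + complex_of_real (((s - t) * M)\<^sup>2) * complex_of_real (norm (U t \<xi>)))"
            by simp
        qed
      qed simp
      also have "\<dots> \<le> l2_norm (\<lambda>\<xi>. complex_of_real \<bar>s - t\<bar> * complex_of_real (norm (R s t \<xi>)))
          + l2_norm (\<lambda>\<xi>. complex_of_real (((s - t) * M)\<^sup>2) * complex_of_real (norm (U t \<xi>)))"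
        unfolding mult_1 by (intro l2_norm_triangle square_integrable_scale nR nU)
      also have "\<dots> = \<bar>s - t\<bar> * l2_norm (R s t) + ((s - t) * M)\<^sup>2 * l2_norm (U t)"
        by (simp only: l2_norm_scale norm_of_real) (simp add: l2_norm_def)
      also have "\<dots> = \<bar>s - t\<bar> * (l2_norm (R s t) + \<bar>s - t\<bar> * (M\<^sup>2 * l2_norm (U t)))"
        by (simp add: algebra_simps power2_eq_square flip: power2_abs)
      finally show ?thesis .
    qed
    \<comment> \<open>Differentiability at 0 is one-sided, as in the equation; on the convex set
      \<open>{0..}\<close> a zero derivative forces N to be constant.\<close>
    have "(N has_field_derivative 0) (at t within {0..})" if "t \<in> {0..}" for t
      unfolding has_field_derivative_iff
    proof (rule Lim_null_comparison)
      show "\<forall>\<^sub>F s in at t within {0..}.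
          norm ((N s - N t) / (s - t)) \<le> l2_norm (R s t) + \<bar>s - t\<bar> * (M\<^sup>2 * l2_norm (U t))"
        unfolding eventually_at_filter
      proof (intro always_eventually allI impI)
        fix s assume "s \<noteq> t" "s \<in> {0..}"
        then show "norm ((N s - N t) / (s - t)) \<le> l2_norm (R s t) + \<bar>s - t\<bar> * (M\<^sup>2 * l2_norm (U t))"
          using Lipschitz[of s t] that by (simp add: abs_divide field_simps)
      qed
      have "((\<lambda>s. l2_norm (R s t) + \<bar>s - t\<bar> * (M\<^sup>2 * l2_norm (U t))) \<longlongrightarrow>
          0 + \<bar>t - t\<bar> * (M\<^sup>2 * l2_norm (U t))) (at t within {0..})"
        using deriv[of t] that unfolding R_def by (intro tendsto_intros) auto
      then show "((\<lambda>s. l2_norm (R s t) + \<bar>s - t\<bar> * (M\<^sup>2 * l2_norm (U t))) \<longlongrightarrow> 0) (at t within {0..})"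
        by simp
    qed
    then obtain c where "\<forall>t\<in>{0..}. N t = c"
      using has_field_derivative_zero_constant[of "{0..}" N] by auto
    then have "N t = N 0" using \<open>t \<ge> 0\<close> by simp
    also have "N 0 = 0" by (simp add: N_def l2_norm_def)
    finally have "l2_norm (\<lambda>\<xi>. D t \<xi> - D 0 \<xi>) = 0"
      by (simp add: N_def)
    then have "AE \<xi> in lborel. D t \<xi> - D 0 \<xi> = 0"
      using \<open>t \<ge> 0\<close> by (intro l2_norm_eq_0_imp_AE square_integrable_diff D) auto
    then show ?thesis
    proof eventually_elim
      case (elim \<xi>)
      show ?case
      proof
        assume "\<bar>m \<xi>\<bar> \<le> M"
        then have "U 0 \<xi> = exp (- \<i> * of_real (t * m \<xi>)) * U t \<xi>"
          using elim by (simp add: D_def)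
        then have "exp (\<i> * complex_of_real (t * m \<xi>)) * U 0 \<xi>
            = (exp (\<i> * complex_of_real (t * m \<xi>)) * exp (- \<i> * of_real (t * m \<xi>))) * U t \<xi>"
          by simp
        then show "U t \<xi> = exp (\<i> * complex_of_real (t * m \<xi>)) * U 0 \<xi>"
          by (simp flip: exp_add)
      qed
    qed
  qed
  \<comment> \<open>The exceptional null set depends on M. Restricting M to the naturals keeps the
    union countable and still reaches every value of |m \<xi>|.\<close>
  have "AE \<xi> in lborel. \<forall>M::nat. \<bar>m \<xi>\<bar> \<le> real M \<longrightarrow>
      U t \<xi> = exp (\<i> * complex_of_real (t * m \<xi>)) * U 0 \<xi>"
    using zero by (subst AE_all_countable) auto
  then show ?thesis
    by eventually_elim (use real_arch_simple in blast)
qed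

text \<open>The operator enters only through its action on transforms, multiplication by a real
  symbol, so one statement covers both equations.\<close>

lemma solves_evolution_has_fourier:
  fixes u0 :: "real ^ 'n \<Rightarrow> complex" and m :: "real ^ 'n \<Rightarrow> real"
  assumes P: "\<And>f g v. P f v \<Longrightarrow> has_fourier f g \<Longrightarrow> has_fourier v (\<lambda>\<xi>. complex_of_real (m \<xi>) * g \<xi>)"
    and [measurable]: "m \<in> borel_measurable borel"
    and u: "solves_evolution P u0 u" and g: "has_fourier u0 g" and t: "t \<ge> 0"
  shows "has_fourier (u t) (\<lambda>\<xi>. exp (\<i> * complex_of_real (t * m \<xi>)) * g \<xi>)"
proof -
  have "\<forall>t\<ge>0. \<exists>g. has_fourier (u t) g"
    using u by (auto simp: solves_evolution_def sobolev_space_def)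
  then obtain U where U: "\<And>t. t \<ge> 0 \<Longrightarrow> has_fourier (u t) (U t)"
    by metis
  note [measurable] = has_fourier_measurable[OF U] has_fourier_measurable[OF g]
  have sol: "\<exists>w. has_time_derivative u w t \<and> has_fourier w (\<lambda>\<xi>. \<i> * complex_of_real (m \<xi>) * U t \<xi>) \<and>
      square_integrable (\<lambda>\<xi>. complex_of_real (m \<xi>) * U t \<xi>)"
    if "t \<ge> 0" for t
  proof -
    obtain w v W where w: "has_time_derivative u w t" "has_fourier w W" and v: "P (u t) v"
      and wv: "AE x in lborel. - \<i> * w x = v x"
      using u \<open>t \<ge> 0\<close> unfolding solves_evolution_def sobolev_space_def by blast
    have V: "has_fourier v (\<lambda>\<xi>. complex_of_real (m \<xi>) * U t \<xi>)"
      by (rule P[OF v U[OF \<open>t \<ge> 0\<close>]])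
    have V': "has_fourier (\<lambda>x. \<i> * v x) (\<lambda>\<xi>. \<i> * complex_of_real (m \<xi>) * U t \<xi>)"
      using has_fourier_scale[OF V, of \<i>] by (simp add: mult.assoc)
    have "AE x in lborel. \<i> * v x = w x"
      using wv
    proof eventually_elim
      case (elim x)
      then show ?case by (simp flip: elim)
    qed
    then have "has_fourier w (\<lambda>\<xi>. \<i> * complex_of_real (m \<xi>) * U t \<xi>)"
      using has_fourier_measurable[OF w(2)] has_fourier_measurable[OF V']
      by (intro has_fourier_cong_AE[OF V']) auto
    then show ?thesis
      using w(1) has_fourier_square_integrable(2)[OF V] by blast
  qed
  have "AE \<xi> in lborel. U t \<xi> = exp (\<i> * complex_of_real (t * m \<xi>)) * U 0 \<xi>"
  proof (rule l2_evolution_unique[OF _ _ _ _ t])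
    fix t :: real assume t: "t \<ge> 0"
    show "square_integrable (U t)" by (rule has_fourier_square_integrable(2)[OF U[OF t]])
    show "square_integrable (\<lambda>\<xi>. complex_of_real (m \<xi>) * U t \<xi>)" using sol[OF t] by blast
    obtain w where w: "has_time_derivative u w t" "has_fourier w (\<lambda>\<xi>. \<i> * complex_of_real (m \<xi>) * U t \<xi>)"
      using sol[OF t] by blast
    \<comment> \<open>The Sobolev norm of order 0 is the L2 norm of a transform, so by linearity the
      strong derivative of u becomes that of U.\<close>
    have "sobolev_norm 0 (\<lambda>x. (u s x - u t x) / complex_of_real (s - t) - w x)
        = l2_norm (\<lambda>\<xi>. (U s \<xi> - U t \<xi>) / complex_of_real (s - t) - \<i> * complex_of_real (m \<xi>) * U t \<xi>)"
      if "s \<ge> 0" for s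
    proof (rule sobolev_norm_0_eq)
      show "has_fourier (\<lambda>x. (u s x - u t x) / complex_of_real (s - t) - w x)
        (\<lambda>\<xi>. (U s \<xi> - U t \<xi>) / complex_of_real (s - t) - \<i> * complex_of_real (m \<xi>) * U t \<xi>)"
        using has_fourier_diff[OF has_fourier_scale[OF has_fourier_diff[OF U[OF that] U[OF t]],
              of "inverse (complex_of_real (s - t))"] w(2)]
        by (simp add: divide_inverse ac_simps)
    qed
    then have "\<forall>\<^sub>F s in at t within {0..}.
        sobolev_norm 0 (\<lambda>x. (u s x - u t x) / complex_of_real (s - t) - w x)
        = l2_norm (\<lambda>\<xi>. (U s \<xi> - U t \<xi>) / complex_of_real (s - t) - \<i> * complex_of_real (m \<xi>) * U t \<xi>)"
      by (simp add: eventually_at_filter)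
    then show "((\<lambda>s. l2_norm (\<lambda>\<xi>. (U s \<xi> - U t \<xi>) / complex_of_real (s - t) - \<i> * complex_of_real (m \<xi>) * U t \<xi>))
        \<longlongrightarrow> 0) (at t within {0..})"
      using w(1) unfolding has_time_derivative_def by (rule Lim_transform_eventually[rotated])
  qed simp
  \<comment> \<open>The solution meets its datum only almost everywhere, which suffices to identify
    the transforms at time 0.\<close>
  moreover have "AE \<xi> in lborel. U 0 \<xi> = g \<xi>"
  proof (rule has_fourier_unique)
    show "has_fourier u0 (U 0)"
      using u U[of 0] by (intro has_fourier_cong_AE[OF U[of 0]]) (auto simp: solves_evolution_def)
  qed (rule g)
  ultimately have "AE \<xi> in lborel. U t \<xi> = exp (\<i> * complex_of_real (t * m \<xi>)) * g \<xi>"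
    by eventually_elim simp
  then show ?thesis
    using has_fourier_measurable(1)[OF U[OF t]] by (intro has_fourier_cong_AE[OF U[OF t]]) auto
qed

section \<open>Comparison of the symbols\<close>

text \<open>Lagrange's remainder: at the intermediate point x > 0 the exponent 1/2 - (r + 1) is
  negative, so the power of 1 + x is at most 1. The bound thus holds for all y \<ge> 0, also beyond
  the radius of convergence of the binomial series, and covers high frequencies as well.\<close>

lemma sqrt_1_plus_taylor:
  fixes y :: real
  assumes "y \<ge> 0"
  shows "\<bar>sqrt (1 + y) - (\<Sum>j\<le>r. ((1 / 2) gchoose j) * y ^ j)\<bar> \<le> \<bar>(1 / 2) gchoose Suc r\<bar> * y ^ Suc r"
proof (cases "y = 0")
  \<comment> \<open>\<open>Maclaurin\<close> is stated for y > 0; at y = 0 only the term j = 0 of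
    the sum survives.\<close>
  case True
  have "(\<Sum>j\<le>r. ((1 / 2 :: real) gchoose j) * 0 ^ j) = 1"
    by (induction r) auto
  then show ?thesis using True by simp
next
  case False
  \<comment> \<open>The m-th derivative of the square root of 1 + x. The falling factorial of 1/2 is
    written as \<open>fact m\<close> times a binomial coefficient, so that division by
    \<open>fact m\<close> yields the Taylor coefficient.\<close>
  define diff where
    "diff m x = fact m * ((1 / 2) gchoose m) * (1 + x) powr (1 / 2 - real m)" for m and x :: real
  have "(diff m has_field_derivative diff (Suc m) x) (at x)" if "x \<ge> 0" for m x
  proof -
    have coeff: "((1 / 2) gchoose m) * (1 / 2 - real m) = real (Suc m) * ((1 / 2) gchoose Suc m)"
      using gbinomial_mult_1[of "1 / 2 :: real" m] by (simp add: algebra_simps)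
    have "(diff m has_field_derivative
        fact m * ((1 / 2) gchoose m) * ((1 / 2 - real m) * (1 + x) powr (1 / 2 - real m - 1))) (at x)"
      unfolding diff_def using that by (auto intro!: derivative_eq_intros)
    also have "fact m * ((1 / 2) gchoose m) * ((1 / 2 - real m) * (1 + x) powr (1 / 2 - real m - 1))
        = fact m * (((1 / 2) gchoose m) * (1 / 2 - real m)) * (1 + x) powr (1 / 2 - real m - 1)"
      by (simp only: mult.assoc)
    also have "\<dots> = diff (Suc m) x"
      unfolding coeff diff_def fact_Suc by (simp add: diff_diff_eq add.commute)
    finally show ?thesis .
  qed
  then have "\<exists>x>0. x < y \<and>
      diff 0 y = (\<Sum>m<Suc r. (diff m 0 / fact m) * y ^ m) + (diff (Suc r) x / fact (Suc r)) * y ^ Suc r"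
    using False assms by (intro Maclaurin) auto
  moreover have "diff 0 y = sqrt (1 + y)"
    using assms by (simp add: diff_def powr_half_sqrt)
  ultimately obtain x where x: "0 < x" "x < y"
    and eq: "sqrt (1 + y) = (\<Sum>m<Suc r. (diff m 0 / fact m) * y ^ m) + (diff (Suc r) x / fact (Suc r)) * y ^ Suc r"
    by metis
  have "(1 + x) powr (1 / 2 - real (Suc r)) \<le> 1"
    using x powr_mono[of "1 / 2 - real (Suc r)" 0 "1 + x"] by simp
  have "sqrt (1 + y) - (\<Sum>j\<le>r. ((1 / 2) gchoose j) * y ^ j)
      = ((1 / 2) gchoose Suc r) * y ^ Suc r * (1 + x) powr (1 / 2 - real (Suc r))"
    unfolding eq lessThan_Suc_atMost by (simp add: diff_def del: fact_Suc of_nat_Suc)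
  also have "\<bar>\<dots>\<bar> = (\<bar>(1 / 2) gchoose Suc r\<bar> * y ^ Suc r) * (1 + x) powr (1 / 2 - real (Suc r))"
    using assms by (simp add: abs_mult)
  also have "\<dots> \<le> (\<bar>(1 / 2) gchoose Suc r\<bar> * y ^ Suc r) * 1"
    using \<open>(1 + x) powr _ \<le> 1\<close> assms by (intro mult_left_mono) auto
  finally show ?thesis by simp
qed

lemma symbol_difference_le:
  fixes \<xi> :: "real ^ 'n"
  assumes "c > 0"
  shows "\<bar>klein_gordon_symbol c \<xi> - normal_form_symbol r c \<xi>\<bar>
    \<le> \<bar>(1 / 2) gchoose Suc r\<bar> * norm \<xi> ^ (2 * Suc r) / c ^ (2 * r)"
proof -
  define y where "y = (norm \<xi>)\<^sup>2 / c\<^sup>2"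
  have y: "y \<ge> 0" by (simp add: y_def)
  have "c\<^sup>2 + (norm \<xi>)\<^sup>2 = c\<^sup>2 * (1 + y)"
    using assms by (simp add: y_def field_simps)
  then have "sqrt (c\<^sup>2 + (norm \<xi>)\<^sup>2) = c * sqrt (1 + y)"
    using assms by (simp add: real_sqrt_mult)
  then have kg: "klein_gordon_symbol c \<xi> = c\<^sup>2 * sqrt (1 + y)"
    by (simp add: klein_gordon_symbol_def power2_eq_square)
  \<comment> \<open>The sign in \<open>nf_coeff j\<close> cancels that of the Laplacian's symbol, so
    each summand is a Taylor term of the square root.\<close>
  have "nf_coeff j / c ^ (2 * (j - 1)) * (- (norm \<xi>)\<^sup>2) ^ j = c\<^sup>2 * (((1 / 2) gchoose j) * y ^ j)"
    if j_range: "j \<in> {1..r}" for j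
  proof -
    \<comment> \<open>Since j is positive, the natural subtraction j - 1 is exact.\<close>
    obtain i where j: "j = Suc i" using j_range by (cases j) auto
    have sign: "(- 1) ^ j * (- (norm \<xi>)\<^sup>2) ^ j = ((norm \<xi>)\<^sup>2) ^ j"
      by (simp flip: power_mult_distrib)
    have scale: "c\<^sup>2 * y ^ j = ((norm \<xi>)\<^sup>2) ^ j / c ^ (2 * (j - 1))"
      using assms by (simp add: y_def j power_divide power_mult)
    have "nf_coeff j / c ^ (2 * (j - 1)) * (- (norm \<xi>)\<^sup>2) ^ j
        = ((1 / 2) gchoose j) * (((- 1) ^ j * (- (norm \<xi>)\<^sup>2) ^ j) / c ^ (2 * (j - 1)))"
      by (simp add: nf_coeff_def)
    also have "\<dots> = c\<^sup>2 * (((1 / 2) gchoose j) * y ^ j)"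
      unfolding sign scale[symmetric] by simp
    finally show ?thesis .
  qed
  then have "normal_form_symbol r c \<xi> = c\<^sup>2 * (1 + (\<Sum>j=1..r. ((1 / 2) gchoose j) * y ^ j))"
    by (simp add: normal_form_symbol_def sum_distrib_left distrib_left)
  \<comment> \<open>The leading c^2 of the symbol supplies the term j = 0.\<close>
  also have "1 + (\<Sum>j=1..r. ((1 / 2) gchoose j) * y ^ j) = (\<Sum>j\<le>r. ((1 / 2) gchoose j) * y ^ j)"
    by (simp add: atMost_atLeast0 sum.atLeast_Suc_atMost)
  finally have "\<bar>klein_gordon_symbol c \<xi> - normal_form_symbol r c \<xi>\<bar>
      = c\<^sup>2 * \<bar>sqrt (1 + y) - (\<Sum>j\<le>r. ((1 / 2) gchoose j) * y ^ j)\<bar>"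
    unfolding kg by (simp add: abs_mult flip: right_diff_distrib)
  also have "\<dots> \<le> c\<^sup>2 * (\<bar>(1 / 2) gchoose Suc r\<bar> * y ^ Suc r)"
    by (intro mult_left_mono sqrt_1_plus_taylor y) simp
  also have "c\<^sup>2 * y ^ Suc r = norm \<xi> ^ (2 * Suc r) / c ^ (2 * r)"
  proof -
    have "c ^ (2 * Suc r) = c\<^sup>2 * c ^ (2 * r)"
      by (simp add: power2_eq_square)
    moreover have "y ^ Suc r = norm \<xi> ^ (2 * Suc r) / c ^ (2 * Suc r)"
      by (simp only: y_def power_divide power_mult)
    ultimately show ?thesis using assms by (simp add: power2_eq_square)
  qed
  then have "c\<^sup>2 * (\<bar>(1 / 2) gchoose Suc r\<bar> * y ^ Suc r) = \<bar>(1 / 2) gchoose Suc r\<bar> * norm \<xi> ^ (2 * Suc r) / c ^ (2 * r)"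
    by (simp only: mult.left_commute[of "c\<^sup>2"] times_divide_eq_right)
  finally show ?thesis .
qed

lemma propagator_difference_le:
  fixes \<xi> :: "real ^ 'n"
  assumes "c > 0" "0 \<le> t" "t \<le> A * c ^ (2 * (r - 1))" "r \<ge> 1"
  shows "norm (exp (\<i> * complex_of_real (t * klein_gordon_symbol c \<xi>))
      - exp (\<i> * complex_of_real (t * normal_form_symbol r c \<xi>)))
    \<le> A * \<bar>(1 / 2) gchoose Suc r\<bar> / c\<^sup>2 * norm \<xi> ^ (2 * Suc r)"
proof -
  let ?b = "\<bar>(1 / 2 :: real) gchoose Suc r\<bar>"
  have "norm (exp (\<i> * complex_of_real (t * klein_gordon_symbol c \<xi>))
      - exp (\<i> * complex_of_real (t * normal_form_symbol r c \<xi>)))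
      \<le> \<bar>t * klein_gordon_symbol c \<xi> - t * normal_form_symbol r c \<xi>\<bar>"
    by (rule norm_exp_i_diff_le)
  also have "\<dots> = t * \<bar>klein_gordon_symbol c \<xi> - normal_form_symbol r c \<xi>\<bar>"
    using assms by (simp add: abs_mult flip: right_diff_distrib)
  also have "\<dots> \<le> A * c ^ (2 * (r - 1)) * (?b * norm \<xi> ^ (2 * Suc r) / c ^ (2 * r))"
    using assms by (intro mult_mono symbol_difference_le order_trans[OF assms(2,3)]) auto
  \<comment> \<open>By r \<ge> 1 the exponents 2 (r - 1) + 2 and 2 r agree; cancelling against the
    length of the time interval leaves 1 / c^2.\<close>
  also have "c ^ (2 * r) = c ^ (2 * (r - 1)) * c\<^sup>2"
    using assms(4) by (cases r) (auto simp: power2_eq_square)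
  then have "A * c ^ (2 * (r - 1)) * (?b * norm \<xi> ^ (2 * Suc r) / c ^ (2 * r)) = A * ?b / c\<^sup>2 * norm \<xi> ^ (2 * Suc r)"
    using assms(1) by simp
  finally show ?thesis .
qed

text \<open>Since |\<xi>|^2 \<le> 1 + |\<xi>|^2, the polynomial growth of the propagator error is
  absorbed into the Sobolev weight. It is applied with n = r + 1, which fixes the loss of
  derivatives.\<close>

lemma weighted_power_le:
  fixes x k :: real
  assumes "x \<ge> 0"
  shows "(1 + x\<^sup>2) powr (k / 2) * x ^ (2 * n) \<le> (1 + x\<^sup>2) powr ((k + real (2 * n)) / 2)"
proof -
  have pos: "1 + x\<^sup>2 > 0"
    by (simp add: add_pos_nonneg)
  have "x ^ (2 * n) \<le> (1 + x\<^sup>2) ^ n"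
    unfolding power_mult by (intro power_mono) auto
  also have "\<dots> = (1 + x\<^sup>2) powr real n"
    using pos by (simp add: powr_realpow)
  finally have "(1 + x\<^sup>2) powr (k / 2) * x ^ (2 * n) \<le> (1 + x\<^sup>2) powr (k / 2) * (1 + x\<^sup>2) powr real n"
    by (intro mult_left_mono) auto
  also have "\<dots> = (1 + x\<^sup>2) powr ((k + real (2 * n)) / 2)"
    by (simp add: add_divide_distrib flip: powr_add)
  finally show ?thesis .
qed

section \<open>The estimate\<close>

theorem theorem2p4:
  assumes "CARD('n::finite) \<ge> 2"
  shows
    "\<exists>\<kappa>::real. \<forall>r::nat. r \<ge> 1 \<longrightarrow>
      (\<exists>k0::real. k0 > 0 \<and>
        (\<forall>k1 k. \<kappa> \<le> k1 \<and> k1 \<le> k \<longrightarrow>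
          (\<exists>cstar::real. cstar > 0 \<and>
            (\<forall>\<psi>0 :: real ^ 'n \<Rightarrow> complex. \<psi>0 \<in> sobolev_space (k + k0) \<longrightarrow>
              (\<forall>A::real. A > 0 \<longrightarrow>
                (\<exists>K::real. K > 0 \<and>
                  (\<forall>c \<psi>r \<psi>. c > cstar \<and>
                     solves_evolution (normal_form_operator r c) \<psi>0 \<psi>r \<and>
                     solves_evolution (klein_gordon_operator c) \<psi>0 \<psi> \<longrightarrow>
                     (\<forall>T. 0 \<le> T \<and> T \<le> A * c ^ (2 * (r - 1)) \<longrightarrow>
                        (\<forall>t\<in>{0..T}. (\<lambda>x. \<psi> t x - \<psi>r t x) \<in> sobolev_space k) \<and>
                        (SUP t\<in>{0..T}. ennreal (sobolev_norm k (\<lambda>x. \<psi> t x - \<psi>r t x)))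
                          \<le> ennreal (K / c\<^sup>2)))))))))"
proof -
  \<comment> \<open>K is found after \<psi>0 and A but before c and the solutions; the threshold c >
    1 is the same for all r and k.\<close>
  have main: "\<exists>K>0. \<forall>c \<psi>r \<psi>. c > 1 \<and>
        solves_evolution (normal_form_operator r c) \<psi>0 \<psi>r \<and>
        solves_evolution (klein_gordon_operator c) \<psi>0 \<psi> \<longrightarrow>
        (\<forall>T. 0 \<le> T \<and> T \<le> A * c ^ (2 * (r - 1)) \<longrightarrow>
           (\<forall>t\<in>{0..T}. (\<lambda>x. \<psi> t x - \<psi>r t x) \<in> sobolev_space k) \<and>
           (SUP t\<in>{0..T}. ennreal (sobolev_norm k (\<lambda>x. \<psi> t x - \<psi>r t x))) \<le> ennreal (K / c\<^sup>2))"
    if r: "r \<ge> 1" and \<psi>0: "\<psi>0 \<in> sobolev_space (k + real (2 * Suc r))" and A: "A > 0"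
    for r :: nat and k A :: real and \<psi>0 :: "real ^ 'n \<Rightarrow> complex"
  proof -
    let ?w = "\<lambda>s \<xi> :: real ^ 'n. complex_of_real ((1 + (norm \<xi>)\<^sup>2) powr (s / 2))"
    let ?b = "\<bar>(1 / 2 :: real) gchoose Suc r\<bar>"
    obtain g where g: "has_fourier \<psi>0 g"
      and G: "square_integrable (\<lambda>\<xi>. ?w (k + real (2 * Suc r)) \<xi> * g \<xi>)"
      using \<psi>0 by (auto simp: sobolev_space_def)
    note [measurable] = has_fourier_measurable[OF g]
    define L where "L = l2_norm (\<lambda>\<xi>. ?w (k + real (2 * Suc r)) \<xi> * g \<xi>)"
    \<comment> \<open>The product combines the Taylor coefficient with the weighted norm of the
      datum; the summand 1 keeps K positive when L = 0.\<close>
    define K where "K = A * ?b * L + 1"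
    have "K > 0" unfolding K_def L_def using A by (intro add_nonneg_pos) auto
    \<comment> \<open>The bound is proved for each single time; the supremum is taken at the end by
      \<open>SUP_least\<close> in \<open>ennreal\<close>.\<close>
    have estimate: "(\<lambda>x. \<psi> t x - \<psi>r t x) \<in> sobolev_space k \<and>
        sobolev_norm k (\<lambda>x. \<psi> t x - \<psi>r t x) \<le> K / c\<^sup>2"
      if c: "c > 1" and \<psi>r: "solves_evolution (normal_form_operator r c) \<psi>0 \<psi>r"
        and \<psi>: "solves_evolution (klein_gordon_operator c) \<psi>0 \<psi>"
        and t: "0 \<le> t" "t \<le> A * c ^ (2 * (r - 1))"
      for c t \<psi>r \<psi>
    proof -
      let ?C = "A * ?b / c\<^sup>2"
      define d where "d \<xi> = exp (\<i> * complex_of_real (t * klein_gordon_symbol c \<xi>)) * g \<xi>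
          - exp (\<i> * complex_of_real (t * normal_form_symbol r c \<xi>)) * g \<xi>" for \<xi>
      have d: "has_fourier (\<lambda>x. \<psi> t x - \<psi>r t x) d"
        unfolding d_def
        by (intro has_fourier_diff
            solves_evolution_has_fourier[OF klein_gordon_operator_has_fourier _ \<psi> g t(1)]
            solves_evolution_has_fourier[OF normal_form_operator_has_fourier _ \<psi>r g t(1)]) auto
      note [measurable] = has_fourier_measurable[OF d]
      have meas: "(\<lambda>\<xi>. ?w k \<xi> * d \<xi>) \<in> borel_measurable borel" by measurable
      \<comment> \<open>The propagator error costs |\<xi>|^(2 r + 2) at each frequency, which raises
        the weight from order k to k + 2 r + 2.\<close>
      have le: "AE \<xi> in lborel. norm (?w k \<xi> * d \<xi>) \<le> ?C * norm (?w (k + real (2 * Suc r)) \<xi> * g \<xi>)"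
      proof (rule AE_I2)
        fix \<xi> :: "real ^ 'n"
        have "norm (d \<xi>) \<le> ?C * norm \<xi> ^ (2 * Suc r) * norm (g \<xi>)"
          unfolding d_def left_diff_distrib[symmetric] norm_mult
          using c t r by (intro mult_right_mono propagator_difference_le) auto
        then have "norm (?w k \<xi> * d \<xi>)
            \<le> (1 + (norm \<xi>)\<^sup>2) powr (k / 2) * (?C * norm \<xi> ^ (2 * Suc r) * norm (g \<xi>))"
          unfolding norm_mult norm_of_real abs_of_nonneg[OF powr_ge_zero] by (rule mult_left_mono) simp
        also have "\<dots> = ?C * (((1 + (norm \<xi>)\<^sup>2) powr (k / 2) * norm \<xi> ^ (2 * Suc r)) * norm (g \<xi>))"
          by (simp only: ac_simps)
        also have "\<dots> \<le> ?C * ((1 + (norm \<xi>)\<^sup>2) powr ((k + real (2 * Suc r)) / 2) * norm (g \<xi>))"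
          using A by (intro mult_left_mono mult_right_mono weighted_power_le) auto
        finally show "norm (?w k \<xi> * d \<xi>) \<le> ?C * norm (?w (k + real (2 * Suc r)) \<xi> * g \<xi>)"
          by (simp add: norm_mult)
      qed
      have "square_integrable (\<lambda>\<xi>. ?w k \<xi> * d \<xi>)"
        by (rule square_integrable_bound[OF G meas le])
      moreover have "sobolev_norm k (\<lambda>x. \<psi> t x - \<psi>r t x) \<le> ?C * L"
        unfolding sobolev_norm_eq[OF d] L_def using A by (intro l2_norm_mono[OF G meas _ le]) simp
      moreover have "?C * L \<le> K / c\<^sup>2"
        by (simp add: K_def divide_right_mono)
      ultimately show ?thesis
        using d unfolding sobolev_space_def by fastforce
    qed
    then show ?thesis
      using \<open>K > 0\<close> by (intro exI[of _ K]) (auto intro!: SUP_least ennreal_leI)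
  qed
  \<comment> \<open>The witnesses are \<kappa> = 0, k0 = 2 (r + 1) and cstar = 1.\<close>
  show ?thesis
  proof (rule exI[of _ "0 :: real"], intro allI impI, goal_cases)
    case (1 r)
    show ?case
    proof (rule exI[of _ "real (2 * Suc r)"], intro conjI allI impI, goal_cases)
      case (2 k1 k)
      show ?case
        by (rule exI[of _ "1 :: real"], intro conjI allI impI main 1) auto
    qed simp
  qed
qed

end
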